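(* Let $P$ be a finite nonempty set consisting of primes, and let $M_P := \sum_{p \in P} \mathbb{N}_0\big[\frac1p\big]$. Then each $q \in M_P$ can be written uniquely as $$q = c_0 + \sum_{(p,n) \in P \times \mathbb{N}} c_{p,n} \frac{1}{p^n},$$ where $c_0 \in \mathbb{N}_0$ and, for each $p \in P$, the sequence $(c_{p,n})_{n \ge 1}$ consists of nonnegative integer coefficients, almost all being zero, such that $0 \le c_{p,n} < p$ for every $n \in \mathbb{N}$.
   Context: For a prime $p$, $\mathbb{N}_0[1/p] = \{f(1/p) : f(x) \in \mathbb{N}_0[x]\}$, regarded as an additive submonoid of $\mathbb{Q}_{\ge 0}$. The sum defining $M_P$ is the internal sum inside $\mathbb{Q}_{\ge 0}$: $M_P = \{\sum_{p \in P} m_p : m_p \in \mathbb{N}_0[1/p] \text{ for all } p \in P\}$. Here $\mathbb{N} = \{1,2,3,\dots\}$, $\mathbb{N}_0 = \mathbb{N} \cup \{0\}$. *)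

theory Defs
  imports
    "HOL-Library.FuncSet"
    "HOL-Computational_Algebra.Polynomial"
    "HOL-Computational_Algebra.Primes"
begin

definition nat_adjoin_inverse :: "nat \<Rightarrow> rat set" where
  "nat_adjoin_inverse p = {poly (map_poly of_nat f) (1 / of_nat p) | f :: nat poly. True}"

definition sum_monoid :: "nat set \<Rightarrow> rat set" where
  "sum_monoid P = {(\<Sum>p\<in>P. m p) | m :: nat \<Rightarrow> rat. \<forall>p\<in>P. m p \<in> nat_adjoin_inverse p}"

text \<open>
  A coefficient family is a function on the index set \<open>P \<times> {1, 2, 3, \<dots>}\<close>; HOL functions being
  total, it is made extensional (\<open>undefined\<close> outside the index set) so that equality of families
  is equality on the index set.  Since \<open>sum\<close> vanishes on infinite sets, the series is summed
  over the support of the family, which is finite when \<open>P\<close> is finite.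
\<close>

definition is_expansion :: "nat set \<Rightarrow> rat \<Rightarrow> nat \<Rightarrow> (nat \<times> nat \<Rightarrow> nat) \<Rightarrow> bool" where
  "is_expansion P q c\<^sub>0 c \<longleftrightarrow>
     c \<in> extensional (P \<times> {1..}) \<and>
     (\<forall>p\<in>P. finite {n \<in> {1..}. c (p, n) \<noteq> 0}) \<and>
     (\<forall>p\<in>P. \<forall>n\<in>{1..}. c (p, n) < p) \<and>
     q = of_nat c\<^sub>0 +
         (\<Sum>(p, n) \<in> {(p, n) \<in> P \<times> {1..}. c (p, n) \<noteq> 0}. of_nat (c (p, n)) * (1 / of_nat p ^ n))"

end

(*
  The digits of the p-part are read as a polynomial f over the naturals with coefficients below p,
  so that the p-part is f(1/p)/p, a number in [0,1).  Existence is division with remainder by p,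
  carried along the coefficients (Horner scheme).  For uniqueness, take two expansions of q and
  let x be the difference of their p-parts.  Some power of p clears its denominators; but x is
  also an integer minus a sum of fractions whose denominators are powers of the other primes, so a
  number coprime to p clears them as well.  Hence x is an integer with |x| < 1, that is x = 0, and
  digits are determined by taking integral parts.
*)

theory Submission
  imports Defs
begin

section \<open>Polynomials at \<open>1/p\<close> and base-\<open>p\<close> digits\<close>

definition eval_inv :: "nat \<Rightarrow> nat poly \<Rightarrow> rat" where
  "eval_inv p f = poly (map_poly of_nat f) (1 / of_nat p)"

text \<open>Coefficient \<open>i\<close> is the digit at \<open>1/p^(i+1)\<close>. The bound also
  ranges over indices beyond the degree, so membership forces \<open>0 < p\<close>.\<close>

definition digit_polys :: "nat \<Rightarrow> nat poly set" where
  "digit_polys p = {f. \<forall>i. coeff f i < p}"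

lemma eval_inv_0 [simp]: "eval_inv p 0 = 0"
  by (simp add: eval_inv_def)

lemma eval_inv_pCons [simp]:
  "eval_inv p (pCons a f) = of_nat a + eval_inv p f / of_nat p"
  by (simp add: eval_inv_def map_poly_pCons)

lemma eval_inv_altdef:
  "eval_inv p f = (\<Sum>i\<le>degree f. of_nat (coeff f i) * (1 / of_nat p) ^ i)"
  by (simp add: eval_inv_def poly_altdef coeff_map_poly degree_map_poly)

lemma pCons_in_digit_polys:
  "pCons a f \<in> digit_polys p \<longleftrightarrow> a < p \<and> f \<in> digit_polys p"
  by (auto simp: digit_polys_def coeff_pCons split: nat.splits)

lemma digit_polys_pos: "f \<in> digit_polys p \<Longrightarrow> 0 < p"
  unfolding digit_polys_def using gr_zeroI by fastforce

lemma eval_inv_nonneg: "0 \<le> eval_inv p f"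
  by (induction f) auto

text \<open>By induction the tail divided by \<open>p\<close> is below 1, and \<open>a < p\<close>
  means \<open>a + 1 \<le> p\<close>. Strictness reflects finiteness: infinitely many digits
  \<open>p - 1\<close> would reach \<open>p\<close>.\<close>

lemma eval_inv_digits_less:
  assumes "f \<in> digit_polys p"
  shows "eval_inv p f < of_nat p"
  using assms
proof (induction f)
  case 0
  then show ?case using digit_polys_pos by force
next
  case (pCons a f)
  then have "a < p" "eval_inv p f < of_nat p" by (auto simp: pCons_in_digit_polys)
  then have "eval_inv p f / of_nat p < 1" "(of_nat a :: rat) + 1 \<le> of_nat p"
    by (auto simp flip: of_nat_Suc simp del: of_nat_Suc simp add: of_nat_le_iff Suc_le_eq add.commute)
  then show ?case unfolding eval_inv_pCons by linarith
qed

lemma eval_inv_div_bounds: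
  assumes "f \<in> digit_polys p"
  shows "0 \<le> eval_inv p f / of_nat p" "eval_inv p f / of_nat p < 1"
  using eval_inv_nonneg[of p f] eval_inv_digits_less[OF assms] digit_polys_pos[OF assms] by auto

text \<open>The tail divided by \<open>p\<close> lies in [0,1), so the floor recovers the constant
  coefficient; cancelling it leaves the same question for the tails.\<close>

lemma eval_inv_inj_on_digits:
  assumes "f \<in> digit_polys p" "g \<in> digit_polys p" "eval_inv p f = eval_inv p g"
  shows "f = g"
  using assms
proof (induction f g rule: poly_induct2)
  case 0
  then show ?case by simp
next
  case (pCons a f b g)
  from pCons.prems have fg: "f \<in> digit_polys p" "g \<in> digit_polys p" and "0 < p"
    by (auto simp: pCons_in_digit_polys)
  have eq: "(of_nat a :: rat) + eval_inv p f / of_nat p = of_nat b + eval_inv p g / of_nat p"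
    using pCons.prems by simp
  have "\<lfloor>(of_nat a :: rat) + eval_inv p f / of_nat p\<rfloor> = int a"
    "\<lfloor>(of_nat b :: rat) + eval_inv p g / of_nat p\<rfloor> = int b"
    using eval_inv_div_bounds[OF fg(1)] eval_inv_div_bounds[OF fg(2)] by (auto intro!: floor_unique)
  with eq have "a = b" by simp
  with eq \<open>0 < p\<close> pCons.IH fg show ?case by simp
qed

lemma eval_inv_carry:
  assumes "0 < p"
  shows "\<exists>k. \<exists>f\<in>digit_polys p. eval_inv p g = of_nat k + eval_inv p f / of_nat p"
proof (induction g)
  case 0
  show ?case using assms by (intro exI[of _ 0] bexI[of _ 0]) (auto simp: digit_polys_def)
next
  case (pCons a g)
  then obtain k f where f: "f \<in> digit_polys p"
    and g: "eval_inv p g = of_nat k + eval_inv p f / of_nat p" by blast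
  \<comment> \<open>The carry \<open>k\<close> of the tail has weight \<open>1/p\<close> here: its
    quotient by \<open>p\<close> joins the integer part, its remainder becomes the first
    digit.\<close>
  have "(of_nat k :: rat) = of_nat (k div p) * of_nat p + of_nat (k mod p)"
    by (metis div_mult_mod_eq of_nat_add of_nat_mult)
  then have "eval_inv p (pCons a g) =
      of_nat (a + k div p) + eval_inv p (pCons (k mod p) f) / of_nat p"
    using assms by (simp add: g field_simps)
  moreover have "pCons (k mod p) f \<in> digit_polys p"
    using f assms by (simp add: pCons_in_digit_polys)
  ultimately show ?case by blast
qed

section \<open>Clearing denominators and uniqueness of the digits\<close>

lemma eval_inv_clear_denominator:
  assumes "0 < p"
  shows "\<exists>N. of_nat (p ^ N) * eval_inv p f \<in> \<int>"
proof (induction f)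
  case 0
  show ?case by simp
next
  case (pCons a f)
  then obtain N where N: "of_nat (p ^ N) * eval_inv p f \<in> \<int>" by blast
  have "of_nat (p ^ Suc N) * eval_inv p (pCons a f) =
      of_nat (p ^ Suc N * a) + of_nat (p ^ N) * eval_inv p f"
    using assms by (simp add: field_simps)
  also have "\<dots> \<in> \<int>" using N by (intro Ints_add Ints_of_nat)
  finally show ?case by blast
qed

lemma eval_inv_diff_clear_denominator:
  assumes "0 < p"
  shows "\<exists>N. of_nat (p ^ N) * (eval_inv p f / of_nat p - eval_inv p g / of_nat p) \<in> \<int>"
proof -
  obtain M N where MN: "of_nat (p ^ M) * eval_inv p f \<in> \<int>" "of_nat (p ^ N) * eval_inv p g \<in> \<int>"
    using eval_inv_clear_denominator[OF assms] by meson
  \<comment> \<open>\<open>M\<close> and \<open>N\<close> serve the two evaluations; the extra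
    factor cancels the outer division by \<open>p\<close>.\<close>
  have "of_nat (p ^ (Suc (M + N))) * (eval_inv p f / of_nat p - eval_inv p g / of_nat p) =
      of_nat (p ^ N) * (of_nat (p ^ M) * eval_inv p f) -
      of_nat (p ^ M) * (of_nat (p ^ N) * eval_inv p g)"
    using assms by (simp add: field_simps power_add)
  also have "\<dots> \<in> \<int>" by (intro Ints_diff Ints_mult[OF Ints_of_nat MN(1)] Ints_mult[OF Ints_of_nat MN(2)])
  finally show ?thesis by blast
qed

text \<open>The product of the clearing powers works for the whole sum, and products of numbers
  coprime to \<open>p\<close> stay coprime to \<open>p\<close>.\<close>

lemma sum_clear_denominators_coprime:
  fixes x :: "nat \<Rightarrow> rat"
  assumes "finite A" "\<And>r. r \<in> A \<Longrightarrow> coprime r p" "\<And>r. r \<in> A \<Longrightarrow> \<exists>N. of_nat (r ^ N) * x r \<in> \<int>"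
  shows "\<exists>M. coprime M p \<and> of_nat M * (\<Sum>r\<in>A. x r) \<in> \<int>"
  using assms
proof (induction A)
  case empty
  show ?case by (intro exI[of _ 1]) simp
next
  case (insert r A)
  then obtain M where M: "coprime M p" "of_nat M * (\<Sum>r\<in>A. x r) \<in> \<int>" by auto
  obtain N where N: "of_nat (r ^ N) * x r \<in> \<int>" using insert.prems by auto
  have "of_nat (r ^ N * M) * (\<Sum>r\<in>insert r A. x r) =
      of_nat M * (of_nat (r ^ N) * x r) + of_nat (r ^ N) * (of_nat M * (\<Sum>r\<in>A. x r))"
    using insert.hyps by (simp add: algebra_simps)
  also have "\<dots> \<in> \<int>" by (intro Ints_add Ints_mult[OF Ints_of_nat N] Ints_mult[OF Ints_of_nat M(2)])
  finally have "of_nat (r ^ N * M) * (\<Sum>r\<in>insert r A. x r) \<in> \<int>" .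
  moreover have "coprime (r ^ N * M) p" using M insert.prems by simp
  ultimately show ?case by blast
qed

text \<open>Bezout: \<open>u * a + v * b = 1\<close> makes \<open>x\<close> an integral combination
  of \<open>a * x\<close> and \<open>b * x\<close>.\<close>

lemma Ints_if_coprime_multiples:
  fixes x :: rat
  assumes "coprime a b" "of_nat a * x \<in> \<int>" "of_nat b * x \<in> \<int>"
  shows "x \<in> \<int>"
proof -
  have "gcd (int a) (int b) = 1" using assms(1) by simp
  then obtain u v where "u * int a + v * int b = 1" by (metis bezout_int)
  then have "(of_int (u * int a + v * int b) :: rat) = 1" by (simp only: of_int_1)
  then have "x = (of_int u * of_nat a + of_int v * of_nat b) * x" by simp
  also have "\<dots> = of_int u * (of_nat a * x) + of_int v * (of_nat b * x)"
    by (simp add: algebra_simps)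
  also have "\<dots> \<in> \<int>" using assms by (intro Ints_add Ints_mult[OF Ints_of_int])
  finally show ?thesis .
qed

text \<open>The integer parts \<open>a\<close> and \<open>b\<close> may differ a priori, since they
  only shift the difference of the \<open>p\<close>-parts by an integer.\<close>

lemma digit_polys_unique:
  assumes "finite P" "\<And>p. p \<in> P \<Longrightarrow> prime p"
    and F: "\<And>p. p \<in> P \<Longrightarrow> F p \<in> digit_polys p"
    and G: "\<And>p. p \<in> P \<Longrightarrow> G p \<in> digit_polys p"
    and eq: "of_nat a + (\<Sum>p\<in>P. eval_inv p (F p) / of_nat p) =
      of_nat b + (\<Sum>p\<in>P. eval_inv p (G p) / of_nat p)"
    and p: "p \<in> P"
  shows "F p = G p"
proof -
  define x where "x r = eval_inv r (F r) / of_nat r - eval_inv r (G r) / of_nat r" for r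
  have pos: "0 < r" if "r \<in> P" for r using assms(2)[OF that] prime_gt_0_nat by blast
  have clear: "\<exists>N. of_nat (r ^ N) * x r \<in> \<int>" if "r \<in> P" for r
    unfolding x_def by (rule eval_inv_diff_clear_denominator) (rule pos[OF that])
  have "(\<Sum>r\<in>P. x r) = of_nat b - of_nat a"
    using eq by (simp add: x_def sum_subtractf algebra_simps)
  \<comment> \<open>Isolating \<open>x p\<close> leaves only primes other than \<open>p\<close> on
    the right, whose denominators are coprime to \<open>p\<close>.\<close>
  then have xp: "x p = of_nat b - of_nat a - (\<Sum>r\<in>P - {p}. x r)"
    using assms(1) p by (simp add: sum.remove)
  have "\<exists>M. coprime M p \<and> of_nat M * (\<Sum>r\<in>P - {p}. x r) \<in> \<int>"
    using assms(1,2) p clear by (intro sum_clear_denominators_coprime) (auto intro: primes_coprime)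
  then obtain M where M: "coprime M p" "of_nat M * (\<Sum>r\<in>P - {p}. x r) \<in> \<int>" by blast
  have "of_nat M * x p = of_nat M * (of_nat b - of_nat a) - of_nat M * (\<Sum>r\<in>P - {p}. x r)"
    unfolding xp by (simp only: right_diff_distrib)
  then have Mx: "of_nat M * x p \<in> \<int>"
    using M(2) by (auto intro!: Ints_diff Ints_mult)
  obtain N where N: "of_nat (p ^ N) * x p \<in> \<int>" using clear[OF p] by blast
  have "x p \<in> \<int>"
    by (rule Ints_if_coprime_multiples[OF _ Mx N]) (use M(1) in simp)
  \<comment> \<open>Both \<open>p\<close>-parts lie in [0,1).\<close>
  moreover have "\<bar>x p\<bar> < 1"
    using eval_inv_div_bounds[OF F[OF p]] eval_inv_div_bounds[OF G[OF p]]
    unfolding x_def by linarith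
  ultimately have "x p = 0" using Ints_nonzero_abs_less1 by blast
  then have "eval_inv p (F p) = eval_inv p (G p)" using pos[OF p] by (simp add: x_def)
  then show ?thesis using eval_inv_inj_on_digits F G p by blast
qed

section \<open>From coefficient families to digit polynomials\<close>

lemma sum_expansion_eq:
  fixes c :: "nat \<times> nat \<Rightarrow> nat"
  assumes "finite P" and c: "\<And>p i. p \<in> P \<Longrightarrow> c (p, Suc i) = coeff (F p) i"
  shows "(\<Sum>(p, n) \<in> {(p, n) \<in> P \<times> {1..}. c (p, n) \<noteq> 0}.
      of_nat (c (p, n)) * (1 / of_nat p ^ n)) = (\<Sum>p\<in>P. eval_inv p (F p) / (of_nat p :: rat))"
proof -
  let ?S = "\<lambda>p. {n \<in> {1..}. c (p, n) \<noteq> 0}"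
  have S: "?S p = Suc ` {i. coeff (F p) i \<noteq> 0}" if "p \<in> P" for p
    using c[OF that] by (auto simp: image_iff Suc_le_eq gr0_conv_Suc)
  have supp: "{i. coeff (F p) i \<noteq> 0} \<subseteq> {..degree (F p)}" for p
    using le_degree by auto
  have fin: "finite (?S p)" if "p \<in> P" for p
    unfolding S[OF that] using finite_subset[OF supp] by blast
  have "{(p, n) \<in> P \<times> {1..}. c (p, n) \<noteq> 0} = Sigma P ?S" by auto
  then have "(\<Sum>(p, n) \<in> {(p, n) \<in> P \<times> {1..}. c (p, n) \<noteq> 0}.
      of_nat (c (p, n)) * (1 / of_nat p ^ n)) =
      (\<Sum>p\<in>P. \<Sum>n\<in>?S p. of_nat (c (p, n)) * (1 / (of_nat p :: rat) ^ n))"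
    using assms(1) fin by (simp add: sum.Sigma)
  also have "\<dots> = (\<Sum>p\<in>P. eval_inv p (F p) / of_nat p)"
  proof (rule sum.cong[OF refl])
    fix p assume p: "p \<in> P"
    \<comment> \<open>The shift \<open>n = Suc i\<close> produces the extra division by
      \<open>p\<close>.\<close>
    have "(\<Sum>n\<in>?S p. of_nat (c (p, n)) * (1 / (of_nat p :: rat) ^ n)) =
        (\<Sum>i | coeff (F p) i \<noteq> 0. of_nat (coeff (F p) i) * (1 / of_nat p) ^ i / of_nat p)"
      unfolding S[OF p] by (subst sum.reindex) (auto simp: c[OF p] field_simps)
    also have "\<dots> = (\<Sum>i\<le>degree (F p). of_nat (coeff (F p) i) * (1 / of_nat p) ^ i / of_nat p)"
      using supp by (intro sum.mono_neutral_left) auto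
    finally show "(\<Sum>n\<in>?S p. of_nat (c (p, n)) * (1 / (of_nat p :: rat) ^ n)) =
        eval_inv p (F p) / of_nat p"
      by (simp add: eval_inv_altdef sum_divide_distrib)
  qed
  finally show ?thesis .
qed

text \<open>Finite support of each digit sequence is exactly what makes it the coefficient sequence
  of a polynomial. Existence and uniqueness can then be argued with polynomials alone.\<close>

lemma is_expansion_iff:
  assumes "finite P"
  shows "is_expansion P q a c \<longleftrightarrow> c \<in> extensional (P \<times> {1..}) \<and>
    (\<exists>F. (\<forall>p\<in>P. F p \<in> digit_polys p \<and> (\<forall>i. c (p, Suc i) = coeff (F p) i)) \<and>
      q = of_nat a + (\<Sum>p\<in>P. eval_inv p (F p) / of_nat p))"
    (is "_ \<longleftrightarrow> _ \<and> (\<exists>F. ?R F)")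
proof (intro iffI conjI; (elim conjE exE)?)
  assume exp: "is_expansion P q a c"
  then show "c \<in> extensional (P \<times> {1..})" by (simp add: is_expansion_def)
  define F where "F p = Abs_poly (\<lambda>i. c (p, Suc i))" for p
  have F: "coeff (F p) i = c (p, Suc i)" if "p \<in> P" for p i
  proof -
    have "finite {n \<in> {1..}. c (p, n) \<noteq> 0}" using exp that by (simp add: is_expansion_def)
    \<comment> \<open>\<open>Abs_poly\<close> has the prescribed coefficients once almost all of
      them vanish.\<close>
    then have "finite (Suc -` {n \<in> {1..}. c (p, n) \<noteq> 0})" by (rule finite_vimageI) simp
    then have "\<forall>\<^sub>\<infinity>i. c (p, Suc i) = 0" by (simp add: MOST_iff_cofinite vimage_def)
    then show ?thesis by (simp add: F_def Abs_poly_inverse)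
  qed
  have "F p \<in> digit_polys p" if "p \<in> P" for p
    using exp that by (simp add: digit_polys_def F is_expansion_def)
  moreover have "q = of_nat a + (\<Sum>p\<in>P. eval_inv p (F p) / of_nat p)"
    using exp sum_expansion_eq[OF assms, of c F] by (simp add: is_expansion_def F)
  ultimately show "\<exists>F. ?R F" using F by (intro exI[of _ F]) simp
next
  fix F
  assume ext: "c \<in> extensional (P \<times> {1..})"
    and F: "\<forall>p\<in>P. F p \<in> digit_polys p \<and> (\<forall>i. c (p, Suc i) = coeff (F p) i)"
    and q: "q = of_nat a + (\<Sum>p\<in>P. eval_inv p (F p) / of_nat p)"
  have "finite {n \<in> {1..}. c (p, n) \<noteq> 0}" if "p \<in> P" for p
  proof (rule finite_subset)
    show "{n \<in> {1..}. c (p, n) \<noteq> 0} \<subseteq> Suc ` {..degree (F p)}"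
      using F that le_degree[of "F p"] by (force simp: image_iff Suc_le_eq gr0_conv_Suc)
  qed simp
  moreover have "c (p, n) < p" if "p \<in> P" "n \<ge> 1" for p n
    using F that by (cases n) (auto simp: digit_polys_def)
  ultimately show "is_expansion P q a c"
    using ext F q sum_expansion_eq[OF assms, of c F] by (auto simp: is_expansion_def)
qed

theorem proposition5p14:
  fixes P :: "nat set" and q :: rat
  assumes "finite P" and "P \<noteq> {}" and "\<And>p. p \<in> P \<Longrightarrow> prime p"
    and "q \<in> sum_monoid P"
  shows "\<exists>!r :: nat \<times> (nat \<times> nat \<Rightarrow> nat). case r of (c\<^sub>0, c) \<Rightarrow> is_expansion P q c\<^sub>0 c"
proof (rule ex_ex1I)
  obtain m where q: "q = (\<Sum>p\<in>P. m p)" and m: "\<forall>p\<in>P. m p \<in> nat_adjoin_inverse p"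
    using assms(4) by (auto simp: sum_monoid_def)
  have "\<exists>k f. f \<in> digit_polys p \<and> m p = of_nat k + eval_inv p f / of_nat p" if "p \<in> P" for p
  proof -
    have "0 < p" using assms(3)[OF that] prime_gt_0_nat by blast
    moreover have "m p \<in> nat_adjoin_inverse p" using m that by blast
    then obtain g where "m p = eval_inv p g"
      by (auto simp: nat_adjoin_inverse_def eval_inv_def)
    ultimately show ?thesis using eval_inv_carry[of p g] by auto
  qed
  then obtain k F where F: "\<And>p. p \<in> P \<Longrightarrow> F p \<in> digit_polys p"
    and mF: "\<And>p. p \<in> P \<Longrightarrow> m p = of_nat (k p) + eval_inv p (F p) / of_nat p"
    by metis
  \<comment> \<open>Indices start at 1, so \<open>n - 1\<close> is a true predecessor on the index
    set.\<close>
  define c where "c = restrict (\<lambda>(p, n). coeff (F p) (n - 1)) (P \<times> {1..})"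
  \<comment> \<open>The integers carried out of the separate \<open>p\<close>-parts add up to the
    single \<open>c\<^sub>0\<close>.\<close>
  have "q = of_nat (\<Sum>p\<in>P. k p) + (\<Sum>p\<in>P. eval_inv p (F p) / of_nat p)"
    by (simp add: q mF sum.distrib)
  moreover have "\<forall>p\<in>P. F p \<in> digit_polys p \<and> (\<forall>i. c (p, Suc i) = coeff (F p) i)"
    using F by (simp add: c_def)
  moreover have "c \<in> extensional (P \<times> {1..})" by (simp add: c_def)
  ultimately have "is_expansion P q (\<Sum>p\<in>P. k p) c"
    unfolding is_expansion_iff[OF assms(1)] by blast
  then show "\<exists>r. case r of (c\<^sub>0, c) \<Rightarrow> is_expansion P q c\<^sub>0 c" by blast
next
  fix r s :: "nat \<times> (nat \<times> nat \<Rightarrow> nat)"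
  assume rs: "case r of (c\<^sub>0, c) \<Rightarrow> is_expansion P q c\<^sub>0 c"
    "case s of (c\<^sub>0, c) \<Rightarrow> is_expansion P q c\<^sub>0 c"
  obtain a c b d where r: "r = (a, c)" and s: "s = (b, d)" by (cases r, cases s)
  obtain F where F: "\<forall>p\<in>P. F p \<in> digit_polys p \<and> (\<forall>i. c (p, Suc i) = coeff (F p) i)"
    and qF: "q = of_nat a + (\<Sum>p\<in>P. eval_inv p (F p) / of_nat p)"
    and c: "c \<in> extensional (P \<times> {1..})"
    using rs(1) is_expansion_iff[OF assms(1)] r by auto
  obtain G where G: "\<forall>p\<in>P. G p \<in> digit_polys p \<and> (\<forall>i. d (p, Suc i) = coeff (G p) i)"
    and qG: "q = of_nat b + (\<Sum>p\<in>P. eval_inv p (G p) / of_nat p)"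
    and d: "d \<in> extensional (P \<times> {1..})"
    using rs(2) is_expansion_iff[OF assms(1)] s by auto
  have FG: "F p = G p" if "p \<in> P" for p
    by (rule digit_polys_unique[OF assms(1,3) _ _ trans[OF qF[symmetric] qG] that])
      (use F G in auto)
  have "c = d"
  proof (rule extensionalityI[OF c d])
    fix x :: "nat \<times> nat" assume "x \<in> P \<times> {1..}"
    then obtain p i where "x = (p, Suc i)" "p \<in> P" by (auto simp: Suc_le_eq gr0_conv_Suc)
    then show "c x = d x" using F G FG by simp
  qed
  \<comment> \<open>Equal digit polynomials give equal fractional sums, which cancel in the two
    formulas for \<open>q\<close>.\<close>
  moreover have "a = b" using qF qG FG by simp
  ultimately show "r = s" by (simp add: r s)
qed

end
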